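(* Let $\mathcal{Z}=\mathcal{X}\times\mathcal{Y}$, let $F$ be a class of prediction functions $f:\mathcal{X}\to\mathcal{Y}$ parametrized as $f_\theta$, $\theta\in\Theta=\mathbb{R}^m$, and let the loss be $\ell(\theta;(x,y))=L(f_\theta(x),y)$ for a function $L$, continuous in $\theta$, with $|\ell(\theta;z)|\le T_\ell$ for all $\theta\in\Theta$, $z\in\mathcal{Z}$. Let $P_0$ be a distribution on $\mathcal{Z}$ and $\hat P_n$ the empirical distribution of $n$ i.i.d. samples from $P_0$. Fix a weight vector $w\in[1,\infty)^{m+1}$ and the cost $c_w(z_1,z_2)=\|w\odot(z_1-z_2)\|_2^2$. Then there is a numerical constant $k\ge 0$ such that for every $\theta\in\Theta$, $\rho\ge 0$, $\lambda\ge 0$ and $\delta\in(0,1)$, with probability at least $1-\delta$ over the sample, $$\sup_{P:\,W_{c_w}(P,P_0)\le\rho}\mathbb{E}_P[\ell(\theta;Z)]\le \lambda\rho+\mathbb{E}_{\hat P_n}[s_\lambda(\theta;Z)]+\mathcal{R}_n(\widetilde{\ell}\circ F)+kT_\ell\sqrt{\frac{\ln(1/\delta)}{n}}.$$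
   Context: $W_{c}(P,Q)=\inf_{M\in\Pi(P,Q)}\mathbb{E}_{(z,z')\sim M}[c(z,z')]$ is the Wasserstein distance with cost $c$, $\Pi(P,Q)$ being the couplings of $P$ and $Q$; $\odot$ is the coordinatewise product. The robust surrogate is $s_\lambda(\theta;z)=\sup_{\xi\in\mathcal{Z}}\big(\ell(\theta;\xi)-\lambda c_w(\xi,z)\big)$. The class $\widetilde{\ell}\circ F=\{(x,y)\mapsto L(f(x),y)-L(0,y): f\in F\}$, and for a class $G$ of functions on $\mathcal{Z}$, $\mathcal{R}_n(G)=\mathbb{E}\big[\sup_{g\in G}\frac1n\sum_{i=1}^n\sigma_i g(Z_i)\big]$ with $Z_i$ i.i.d. from $P_0$ and $\sigma_i$ i.i.d. uniform signs in $\{-1,+1\}$ independent of the $Z_i$. *)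

theory Defs
  imports "HOL-Probability.Probability"
begin

text \<open>Data space Z = R^m x R, with R^m rendered as extensional functions nat => real
  on the index set {..<m} (so that the dimension m can be quantified inside the statement).\<close>

definition Zmeas :: "nat \<Rightarrow> ((nat \<Rightarrow> real) \<times> real) measure" where
  "Zmeas m = (PiM {..<m} (\<lambda>_. borel)) \<Otimes>\<^sub>M (borel :: real measure)"

definition Theta :: "nat \<Rightarrow> (nat \<Rightarrow> real) set" where
  "Theta m = PiE {..<m} (\<lambda>_. UNIV)"

definition cost_w :: "nat \<Rightarrow> (nat \<Rightarrow> real) \<Rightarrow> ((nat \<Rightarrow> real) \<times> real) \<Rightarrow> ((nat \<Rightarrow> real) \<times> real) \<Rightarrow> real" where
  "cost_w m w z1 z2 =
     (\<Sum>i<m. (w i * (fst z1 i - fst z2 i))\<^sup>2) + (w m * (snd z1 - snd z2))\<^sup>2"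

definition couplings :: "'a measure \<Rightarrow> 'a measure \<Rightarrow> 'a measure \<Rightarrow> ('a \<times> 'a) measure set" where
  "couplings Mz P Q = {M. prob_space M \<and> sets M = sets (Mz \<Otimes>\<^sub>M Mz) \<and>
                          distr M Mz fst = P \<and> distr M Mz snd = Q}"

definition wasserstein :: "'a measure \<Rightarrow> ('a \<Rightarrow> 'a \<Rightarrow> real) \<Rightarrow> 'a measure \<Rightarrow> 'a measure \<Rightarrow> ennreal" where
  "wasserstein Mz c P Q = (INF M \<in> couplings Mz P Q. \<integral>\<^sup>+ zz. ennreal (c (fst zz) (snd zz)) \<partial>M)"

definition dro_risk :: "'a measure \<Rightarrow> 'a set \<Rightarrow> ('a \<Rightarrow> 'a \<Rightarrow> real) \<Rightarrow> ('a \<Rightarrow> real) \<Rightarrow> 'a measure \<Rightarrow> real \<Rightarrow> real" where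
  "dro_risk Mz Zs c loss P0 rho =
     (SUP P \<in> {P. prob_space P \<and> sets P = sets Mz \<and> emeasure P Zs = 1 \<and>
                  wasserstein Mz c P P0 \<le> ennreal rho}. \<integral>z. loss z \<partial>P)"

definition surrogate :: "'a set \<Rightarrow> ('a \<Rightarrow> 'a \<Rightarrow> real) \<Rightarrow> ('a \<Rightarrow> real) \<Rightarrow> real \<Rightarrow> 'a \<Rightarrow> real" where
  "surrogate Zs c loss lam z = (SUP xi \<in> Zs. loss xi - lam * c xi z)"

definition rademacher_dist :: "real measure" where
  "rademacher_dist = measure_pmf (pmf_of_set {-1, 1})"

definition rad_space :: "nat \<Rightarrow> 'a measure \<Rightarrow> (nat \<Rightarrow> 'a \<times> real) measure" where
  "rad_space n P0 = PiM {..<n} (\<lambda>_. P0 \<Otimes>\<^sub>M rademacher_dist)"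

definition rad_integrand :: "nat \<Rightarrow> ('a \<Rightarrow> real) set \<Rightarrow> (nat \<Rightarrow> 'a \<times> real) \<Rightarrow> real" where
  "rad_integrand n G \<omega> = (SUP g \<in> G. (1 / real n) * (\<Sum>i<n. snd (\<omega> i) * g (fst (\<omega> i))))"

definition rademacher_complexity :: "nat \<Rightarrow> 'a measure \<Rightarrow> ('a \<Rightarrow> real) set \<Rightarrow> real" where
  "rademacher_complexity n P0 G = (\<integral>\<omega>. rad_integrand n G \<omega> \<partial>(rad_space n P0))"

definition sample_space :: "nat \<Rightarrow> 'a measure \<Rightarrow> (nat \<Rightarrow> 'a) measure" where
  "sample_space n P0 = PiM {..<n} (\<lambda>_. P0)"

end

theory Submission
  imports Defs
begin

text \<open>Weak duality: if \<open>M\<close> couples \<open>P\<close> with \<open>P\<^sub>0\<close> and has cost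
  at most \<open>\<rho>\<close>, then pointwise \<open>\<ell>(\<xi>) \<le> s\<^sub>\<lambda>(z) + \<lambda> c(\<xi>, z)\<close> integrates to
  \<open>\<bbbE>\<^sub>P[\<ell>] \<le> \<bbbE>\<^sub>P\<^sub>0[s\<^sub>\<lambda>] + \<lambda>\<rho>\<close>. Concentration: \<open>s\<^sub>\<lambda>\<close> takes values in \<open>[-T, T]\<close>, so
  Hoeffding's inequality bounds \<open>\<bbbE>\<^sub>P\<^sub>0[s\<^sub>\<lambda>]\<close> by the empirical mean plus
  \<open>\<surd>2 T \<surd>(ln(1/\<delta>)/n)\<close> with probability \<open>1 - \<delta>\<close>. Symmetry: flipping all signs preserves the
  law of the Rademacher variables, and the supremum at a sign vector plus the supremum at its
  negation is nonnegative, so the Rademacher complexity is nonnegative and may be added.\<close>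

lemma cost_w_nonneg: "0 \<le> cost_w m w a b"
  unfolding cost_w_def by (intro add_nonneg_nonneg sum_nonneg) auto

lemma cost_w_self [simp]: "cost_w m w a a = 0"
  unfolding cost_w_def by simp

lemma continuous_on_cost_w: "continuous_on UNIV (cost_w m w \<xi>)"
  unfolding cost_w_def
  by (intro continuous_intros
      continuous_on_product_then_coordinatewise[OF continuous_on_fst[OF continuous_on_id]])

lemma cost_w_measurable:
  "(\<lambda>zz. cost_w m w (fst zz) (snd zz)) \<in> borel_measurable (Zmeas m \<Otimes>\<^sub>M Zmeas m)"
  unfolding cost_w_def Zmeas_def by measurable

lemma measurable_Zmeas_ident_borel:
  "(\<lambda>z. z) \<in> measurable (Zmeas m) (borel :: ((nat \<Rightarrow> real) \<times> real) measure)"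
proof -
  have "(\<lambda>x. x) \<in> measurable (PiM {..<m} (\<lambda>_. borel)) (PiM UNIV (\<lambda>_::nat. borel :: real measure))"
  proof (rule measurable_PiM_single')
    fix i :: nat
    show "(\<lambda>x. x i) \<in> borel_measurable (PiM {..<m} (\<lambda>_. borel))"
    proof (cases "i < m")
      case True
      then show ?thesis by (intro measurable_component_singleton) auto
    next
      case False
      \<comment> \<open>outside \<open>{..<m}\<close> every point of the product space is \<open>undefined\<close>\<close>
      show ?thesis
        by (rule measurable_cong[THEN iffD2, of _ _ "\<lambda>_. undefined"])
          (use False in \<open>auto simp: space_PiM PiE_def extensional_def\<close>)
    qed
  qed (auto simp: space_PiM)
  then have "(\<lambda>x. x) \<in> measurable (PiM {..<m} (\<lambda>_. borel)) (borel :: (nat \<Rightarrow> real) measure)"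
    by (simp only: measurable_cong_sets[OF refl sets_PiM_equal_borel])
  then have "(\<lambda>x. x) \<circ> fst \<in> measurable (Zmeas m) (borel :: (nat \<Rightarrow> real) measure)"
    unfolding Zmeas_def by (rule measurable_comp[OF measurable_fst])
  then have "fst \<in> measurable (Zmeas m) (borel :: (nat \<Rightarrow> real) measure)"
    by (simp only: o_def)
  moreover have "snd \<in> measurable (Zmeas m) (borel :: real measure)"
    unfolding Zmeas_def by (rule measurable_snd)
  ultimately have "(\<lambda>z. (fst z, snd z)) \<in> measurable (Zmeas m) (borel \<Otimes>\<^sub>M borel)"
    by (rule measurable_Pair)
  then show ?thesis by (simp only: prod.collapse borel_prod)
qed

lemma borel_measurable_Zmeas:
  assumes "g \<in> borel_measurable borel"
  shows "g \<in> borel_measurable (Zmeas m)"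
  using measurable_comp[OF measurable_Zmeas_ident_borel assms] by (simp only: o_def)

lemma surrogate_bdd_above:
  fixes l :: "'a \<Rightarrow> real" and c :: "'a \<Rightarrow> 'a \<Rightarrow> real"
  assumes "\<forall>\<xi>\<in>Zs. l \<xi> \<le> T" and "\<And>\<xi> z. 0 \<le> c \<xi> z" and "0 \<le> lam"
  shows "bdd_above ((\<lambda>\<xi>. l \<xi> - lam * c \<xi> z) ` Zs)"
proof (rule bdd_aboveI2)
  fix \<xi> assume "\<xi> \<in> Zs"
  then show "l \<xi> - lam * c \<xi> z \<le> T"
    using assms mult_nonneg_nonneg[of lam "c \<xi> z"] by fastforce
qed

lemma surrogate_ge:
  fixes l :: "'a \<Rightarrow> real" and c :: "'a \<Rightarrow> 'a \<Rightarrow> real"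
  assumes "\<forall>\<xi>\<in>Zs. l \<xi> \<le> T" and "\<And>\<xi> z. 0 \<le> c \<xi> z" and "0 \<le> lam" and "\<xi> \<in> Zs"
  shows "l \<xi> - lam * c \<xi> z \<le> surrogate Zs c l lam z"
  unfolding surrogate_def by (rule cSUP_upper[OF assms(4) surrogate_bdd_above[OF assms(1-3)]])

lemma surrogate_le:
  fixes l :: "'a \<Rightarrow> real" and c :: "'a \<Rightarrow> 'a \<Rightarrow> real"
  assumes "Zs \<noteq> {}" and "\<forall>\<xi>\<in>Zs. l \<xi> \<le> T" and "\<And>\<xi> z. 0 \<le> c \<xi> z" and "0 \<le> lam"
  shows "surrogate Zs c l lam z \<le> T"
  unfolding surrogate_def
proof (rule cSUP_least[OF assms(1)])
  fix \<xi> assume "\<xi> \<in> Zs"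
  then show "l \<xi> - lam * c \<xi> z \<le> T"
    using assms(2-4) mult_nonneg_nonneg[of lam "c \<xi> z"] by fastforce
qed

lemma abs_surrogate_le:
  fixes l :: "'a \<Rightarrow> real" and c :: "'a \<Rightarrow> 'a \<Rightarrow> real"
  assumes "\<forall>\<xi>\<in>Zs. \<bar>l \<xi>\<bar> \<le> T" and "\<And>\<xi> z. 0 \<le> c \<xi> z" and "\<And>z. c z z = 0" and "0 \<le> lam"
    and "z \<in> Zs"
  shows "\<bar>surrogate Zs c l lam z\<bar> \<le> T"
proof -
  have l_le: "\<forall>\<xi>\<in>Zs. l \<xi> \<le> T" using assms(1) by auto
  have "l z \<le> surrogate Zs c l lam z"
    using surrogate_ge[where c=c and z=z, OF l_le assms(2,4,5)] assms(3) by simp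
  moreover have "surrogate Zs c l lam z \<le> T"
    using surrogate_le[where c=c, OF _ l_le assms(2,4)] assms(5) by blast
  moreover have "\<bar>l z\<bar> \<le> T" using assms(1,5) by blast
  ultimately show ?thesis unfolding abs_le_iff by linarith
qed

lemma borel_measurable_surrogate:
  fixes l :: "'a::topological_space \<Rightarrow> real" and c :: "'a \<Rightarrow> 'a \<Rightarrow> real"
  assumes "Zs \<noteq> {}" and "\<forall>\<xi>\<in>Zs. l \<xi> \<le> T" and "\<And>\<xi> z. 0 \<le> c \<xi> z" and "0 \<le> lam"
    and "\<And>\<xi>. continuous_on UNIV (c \<xi>)"
  shows "surrogate Zs c l lam \<in> borel_measurable borel"
proof (subst borel_measurable_iff_greater, intro allI)
  fix a
  \<comment> \<open>a supremum of continuous functions is lower semicontinuous\<close>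
  have bdd: "bdd_above ((\<lambda>\<xi>. l \<xi> - lam * c \<xi> z) ` Zs)" for z
    by (rule surrogate_bdd_above[OF assms(2-4)])
  have "{z \<in> space borel. a < surrogate Zs c l lam z} = (\<Union>\<xi>\<in>Zs. {z. a < l \<xi> - lam * c \<xi> z})"
    unfolding surrogate_def
    using less_cSUP_iff[OF assms(1) bdd] by auto
  also have "open \<dots>"
  proof (intro open_UN ballI open_Collect_less continuous_on_const)
    fix \<xi>
    show "continuous_on UNIV (\<lambda>z. l \<xi> - lam * c \<xi> z)"
      using assms(5)[of \<xi>] by (intro continuous_on_diff continuous_on_mult continuous_on_const)
  qed
  finally show "{z \<in> space borel. a < surrogate Zs c l lam z} \<in> sets borel" by simp
qed

section \<open>Weak duality\<close>

lemma AE_mem_of_emeasure_1: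
  assumes "prob_space P" and "A \<in> sets P" and "emeasure P A = 1"
  shows "AE x in P. x \<in> A"
proof -
  interpret prob_space P by fact
  show ?thesis using assms(2,3) by (intro AE_prob_1) (simp add: emeasure_eq_measure)
qed

lemma integrable_bounded_on_full_set:
  fixes f :: "'a \<Rightarrow> real"
  assumes "prob_space P" and "A \<in> sets P" and "emeasure P A = 1"
    and "f \<in> borel_measurable P" and "\<forall>x\<in>A. \<bar>f x\<bar> \<le> T"
  shows "integrable P f"
proof -
  interpret prob_space P by fact
  have "AE x in P. norm (f x) \<le> norm T"
    using AE_mem_of_emeasure_1[OF assms(1-3)] by eventually_elim (use assms(5) in auto)
  then show ?thesis by (intro Bochner_Integration.integrable_bound[OF integrable_const[of T] assms(4)])
qed

lemma wasserstein_self: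
  assumes "prob_space P" and "sets P = sets Mz" and "\<And>a. c a a = 0"
    and "(\<lambda>zz. c (fst zz) (snd zz)) \<in> borel_measurable (Mz \<Otimes>\<^sub>M Mz)"
  shows "wasserstein Mz c P P = 0"
proof -
  interpret prob_space P by fact
  define M where "M = distr P (Mz \<Otimes>\<^sub>M Mz) (\<lambda>z. (z, z))"
  have diag: "(\<lambda>z. (z, z)) \<in> measurable P (Mz \<Otimes>\<^sub>M Mz)"
    using assms(2) by (intro measurable_Pair measurable_ident_sets) auto
  have "M \<in> couplings Mz P P"
    unfolding couplings_def M_def using diag assms(2)
    by (auto simp: distr_distr comp_def distr_id2 intro!: prob_space_distr)
  moreover have "(\<integral>\<^sup>+ zz. ennreal (c (fst zz) (snd zz)) \<partial>M) = 0"
    unfolding M_def using diag assms(3,4) by (simp add: nn_integral_distr)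
  ultimately have "wasserstein Mz c P P \<le> 0"
    unfolding wasserstein_def by (metis INF_lower2 order_refl)
  then show ?thesis by simp
qed

lemma nn_integral_le_imp_integral_le:
  fixes f :: "'a \<Rightarrow> real"
  assumes "f \<in> borel_measurable M" and "\<And>x. 0 \<le> f x"
    and bound: "(\<integral>\<^sup>+ x. ennreal (f x) \<partial>M) \<le> ennreal r" and "0 \<le> r"
  shows "integrable M f" and "(\<integral>x. f x \<partial>M) \<le> r"
proof -
  show "integrable M f"
    using le_less_trans[OF bound ennreal_less_top] assms(1,2) by (intro integrableI_nonneg) auto
  have "(\<integral>x. f x \<partial>M) = enn2real (\<integral>\<^sup>+ x. ennreal (f x) \<partial>M)"
    using assms(1,2) by (intro integral_eq_nn_integral) auto
  also have "\<dots> \<le> r"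
    using enn2real_mono[OF bound ennreal_less_top] \<open>0 \<le> r\<close> by simp
  finally show "(\<integral>x. f x \<partial>M) \<le> r" .
qed

lemma coupling_marginals:
  assumes "M \<in> couplings Mz P Q"
  shows "prob_space M" and "sets M = sets (Mz \<Otimes>\<^sub>M Mz)"
    and "fst \<in> measurable M Mz" and "snd \<in> measurable M Mz"
    and "distr M Mz fst = P" and "distr M Mz snd = Q"
    and "prob_space P" and "prob_space Q" and "sets P = sets Mz" and "sets Q = sets Mz"
proof -
  show M: "prob_space M" "sets M = sets (Mz \<Otimes>\<^sub>M Mz)" "distr M Mz fst = P" "distr M Mz snd = Q"
    using assms by (auto simp: couplings_def)
  show fst: "fst \<in> measurable M Mz" and snd: "snd \<in> measurable M Mz"
    using measurable_fst measurable_snd M(2) measurable_cong_sets by blast+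
  show "prob_space P" "prob_space Q"
    using prob_space.prob_space_distr[OF M(1) fst] prob_space.prob_space_distr[OF M(1) snd] M(3,4)
    by auto
  show "sets P = sets Mz" "sets Q = sets Mz" using M(3,4) by auto
qed

lemma coupling_integral_le:
  fixes l s :: "'a \<Rightarrow> real" and c :: "'a \<Rightarrow> 'a \<Rightarrow> real"
  assumes M: "M \<in> couplings Mz P Q" and Zs: "Zs \<in> sets Mz" "emeasure P Zs = 1" "emeasure Q Zs = 1"
    and l: "l \<in> borel_measurable Mz" "\<forall>z\<in>Zs. \<bar>l z\<bar> \<le> T"
    and s: "s \<in> borel_measurable Mz" "\<forall>z\<in>Zs. \<bar>s z\<bar> \<le> T"
    and c: "(\<lambda>zz. c (fst zz) (snd zz)) \<in> borel_measurable (Mz \<Otimes>\<^sub>M Mz)" "\<And>a b. 0 \<le> c a b"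
    and dom: "\<forall>\<xi>\<in>Zs. \<forall>z\<in>Zs. l \<xi> \<le> s z + lam * c \<xi> z" and "0 \<le> lam"
    and cost: "(\<integral>\<^sup>+ zz. ennreal (c (fst zz) (snd zz)) \<partial>M) \<le> ennreal r" and "0 \<le> r"
  shows "(\<integral>z. l z \<partial>P) \<le> (\<integral>z. s z \<partial>Q) + lam * r"
proof -
  note M' = coupling_marginals[OF M]
  interpret prob_space M by (rule M'(1))
  have ZsP: "Zs \<in> sets P" and ZsQ: "Zs \<in> sets Q" using Zs(1) M'(9,10) by auto
  have lP: "l \<in> borel_measurable P" and sQ: "s \<in> borel_measurable Q"
    using l(1) s(1) M'(9,10) measurable_cong_sets by blast+
  have int_l: "integrable M (\<lambda>x. l (fst x))"
    using integrable_bounded_on_full_set[OF M'(7) ZsP Zs(2) lP l(2)] M'(5)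
      integrable_distr_eq[OF M'(3) l(1)] by simp
  have int_s: "integrable M (\<lambda>x. s (snd x))"
    using integrable_bounded_on_full_set[OF M'(8) ZsQ Zs(3) sQ s(2)] M'(6)
      integrable_distr_eq[OF M'(4) s(1)] by simp
  have "(\<lambda>zz. c (fst zz) (snd zz)) \<in> borel_measurable M"
    using c(1) M'(2) measurable_cong_sets by blast
  note int_c = nn_integral_le_imp_integral_le[OF this c(2) cost \<open>0 \<le> r\<close>]
  have "AE x in M. fst x \<in> Zs" "AE x in M. snd x \<in> Zs"
    using AE_mem_of_emeasure_1[OF M'(7) ZsP Zs(2)] AE_mem_of_emeasure_1[OF M'(8) ZsQ Zs(3)] M'(5,6)
    by (auto intro: AE_distrD[OF M'(3)] AE_distrD[OF M'(4)])
  then have "AE x in M. l (fst x) \<le> s (snd x) + lam * c (fst x) (snd x)"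
    by eventually_elim (use dom in auto)
  moreover have "(\<integral>z. l z \<partial>P) = (\<integral>x. l (fst x) \<partial>M)"
    using integral_distr[OF M'(3) l(1)] M'(5) by simp
  ultimately have "(\<integral>z. l z \<partial>P) \<le> (\<integral>x. s (snd x) + lam * c (fst x) (snd x) \<partial>M)"
    by (auto intro!: integral_mono_AE int_l Bochner_Integration.integrable_add int_s
        integrable_mult_right int_c(1))
  also have "\<dots> = (\<integral>x. s (snd x) \<partial>M) + lam * (\<integral>zz. c (fst zz) (snd zz) \<partial>M)"
    using int_s int_c(1) by simp
  also have "\<dots> \<le> (\<integral>z. s z \<partial>Q) + lam * r"
    using int_c(2) \<open>0 \<le> lam\<close> integral_distr[OF M'(4) s(1)] M'(6) by (simp add: mult_left_mono)
  finally show ?thesis .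
qed

lemma dro_risk_le_surrogate_expectation:
  fixes l s :: "'a \<Rightarrow> real" and c :: "'a \<Rightarrow> 'a \<Rightarrow> real"
  assumes P0: "prob_space P0" "sets P0 = sets Mz" "emeasure P0 Zs = 1" and Zs: "Zs \<in> sets Mz"
    and l: "l \<in> borel_measurable Mz" "\<forall>z\<in>Zs. \<bar>l z\<bar> \<le> T"
    and s: "s \<in> borel_measurable Mz" "\<forall>z\<in>Zs. \<bar>s z\<bar> \<le> T"
    and c: "(\<lambda>zz. c (fst zz) (snd zz)) \<in> borel_measurable (Mz \<Otimes>\<^sub>M Mz)"
      "\<And>a b. 0 \<le> c a b" "\<And>a. c a a = 0"
    and dom: "\<forall>\<xi>\<in>Zs. \<forall>z\<in>Zs. l \<xi> \<le> s z + lam * c \<xi> z" and lam: "0 \<le> lam" and \<rho>: "0 \<le> \<rho>"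
  shows "dro_risk Mz Zs c l P0 \<rho> \<le> lam * \<rho> + (\<integral>z. s z \<partial>P0)"
proof -
  define ball where "ball = {P. prob_space P \<and> sets P = sets Mz \<and> emeasure P Zs = 1 \<and>
                               wasserstein Mz c P P0 \<le> ennreal \<rho>}"
  have "P0 \<in> ball"
    unfolding ball_def using P0 wasserstein_self[OF P0(1,2) c(3,1)] by simp
  moreover have "(\<integral>z. l z \<partial>P) \<le> lam * \<rho> + (\<integral>z. s z \<partial>P0)" if "P \<in> ball" for P
  proof (rule field_le_epsilon)
    fix e :: real assume "0 < e"
    define e' where "e' = e / (lam + 1)"
    have e': "0 < e'" "lam * e' \<le> e" using \<open>0 < e\<close> lam by (auto simp: e'_def field_simps)
    have P: "emeasure P Zs = 1" "wasserstein Mz c P P0 < ennreal (\<rho> + e')"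
      using that e' \<rho> by (auto simp: ball_def intro: le_less_trans ennreal_lessI)
    then obtain M where M: "M \<in> couplings Mz P P0"
      and cost: "(\<integral>\<^sup>+ zz. ennreal (c (fst zz) (snd zz)) \<partial>M) < ennreal (\<rho> + e')"
      unfolding wasserstein_def by (auto simp: INF_less_iff)
    have "(\<integral>z. l z \<partial>P) \<le> (\<integral>z. s z \<partial>P0) + lam * (\<rho> + e')"
      using cost \<rho> e'(1)
      by (intro coupling_integral_le[OF M Zs P(1) P0(3) l s c(1,2) dom lam]) auto
    then show "(\<integral>z. l z \<partial>P) \<le> lam * \<rho> + (\<integral>z. s z \<partial>P0) + e"
      using e'(2) by (simp add: algebra_simps)
  qed
  ultimately show ?thesis
    unfolding dro_risk_def ball_def[symmetric] by (intro cSUP_least) auto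
qed

section \<open>Concentration of the empirical mean\<close>

lemma prob_space_sample_space: "prob_space P \<Longrightarrow> prob_space (sample_space n P)"
  unfolding sample_space_def by (intro prob_space_PiM)

lemma measurable_sample_component: "i < n \<Longrightarrow> (\<lambda>\<omega>. \<omega> i) \<in> measurable (sample_space n P) P"
  unfolding sample_space_def by (intro measurable_component_singleton) auto

lemma distr_sample_component:
  "prob_space P \<Longrightarrow> i < n \<Longrightarrow> distr (sample_space n P) P (\<lambda>\<omega>. \<omega> i) = P"
  unfolding sample_space_def by (intro distr_PiM_component) auto

lemma AE_sample_component:
  "prob_space P \<Longrightarrow> i < n \<Longrightarrow> AE z in P. Q z \<Longrightarrow> AE \<omega> in sample_space n P. Q (\<omega> i)"
  unfolding sample_space_def by (intro AE_PiM_component) auto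

lemma indep_vars_sample_components:
  assumes P: "prob_space P" and "0 < n"
  shows "prob_space.indep_vars (sample_space n P) (\<lambda>_. P) (\<lambda>i \<omega>. \<omega> i) {..<n}"
proof -
  let ?S = "sample_space n P"
  interpret S: prob_space ?S by (rule prob_space_sample_space[OF P])
  have "distr ?S (PiM {..<n} (\<lambda>_. P)) (\<lambda>x. \<lambda>i\<in>{..<n}. x i) = distr ?S ?S (\<lambda>x. x)"
    unfolding sample_space_def
    by (intro distr_cong refl) (auto simp: space_PiM extensional_restrict PiE_def)
  also have "\<dots> = ?S" by (rule distr_id2) simp
  also have "\<dots> = PiM {..<n} (\<lambda>i. distr ?S P (\<lambda>\<omega>. \<omega> i))"
    unfolding sample_space_def by (intro PiM_cong refl distr_PiM_component[symmetric] P) auto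
  finally show ?thesis
    using \<open>0 < n\<close> measurable_sample_component by (subst S.indep_vars_iff_distr_eq_PiM') auto
qed

lemma sample_sum_lower_tail:
  fixes g :: "'a \<Rightarrow> real"
  assumes P: "prob_space P" and g: "g \<in> borel_measurable P"
    and range: "AE z in P. g z \<in> {-T..T}" and "0 < T" and "0 < n" and "0 \<le> t"
  shows "measure (sample_space n P)
           {\<omega> \<in> space (sample_space n P). (\<Sum>i<n. g (\<omega> i)) \<le> real n * (\<integral>z. g z \<partial>P) - real n * t}
         \<le> exp (- real n * t\<^sup>2 / (2 * T\<^sup>2))"
proof -
  let ?S = "sample_space n P"
  interpret S: prob_space ?S by (rule prob_space_sample_space[OF P])
  have mean: "(\<integral>\<omega>. g (\<omega> i) \<partial>?S) = (\<integral>z. g z \<partial>P)" if "i < n" for i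
    using integral_distr[OF measurable_sample_component[OF that] g] distr_sample_component[OF P that]
    by simp
  interpret H: Hoeffding_ineq ?S "{..<n}" "\<lambda>i \<omega>. g (\<omega> i)" "\<lambda>_. -T" "\<lambda>_. T"
      "\<Sum>i\<in>{..<n}. \<integral>\<omega>. g (\<omega> i) \<partial>?S"
  proof unfold_locales
    show "S.indep_vars (\<lambda>_. borel) (\<lambda>i \<omega>. g (\<omega> i)) {..<n}"
      using S.indep_vars_compose2[OF indep_vars_sample_components[OF P \<open>0 < n\<close>], of "\<lambda>_. g"] g
      by simp
  qed (use AE_sample_component[OF P _ range] in auto)
  have "(\<Sum>i\<in>{..<n}. (T - - T)\<^sup>2) = real n * 4 * T\<^sup>2"
    by (simp add: power2_eq_square algebra_simps)
  moreover have "-2 * (real n * t)\<^sup>2 / (real n * 4 * T\<^sup>2) = - real n * t\<^sup>2 / (2 * T\<^sup>2)"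
    using \<open>0 < n\<close> by (simp add: power2_eq_square field_simps)
  ultimately show ?thesis
    using H.Hoeffding_ineq_le[of "real n * t"] mean \<open>0 < T\<close> \<open>0 < n\<close> \<open>0 \<le> t\<close> by simp
qed

lemma sample_in_full_set:
  assumes P: "prob_space P" and Zs: "Zs \<in> sets P" "emeasure P Zs = 1"
  shows "{\<omega> \<in> space (sample_space n P). \<forall>i<n. \<omega> i \<in> Zs} \<in> sets (sample_space n P)"
    and "measure (sample_space n P) {\<omega> \<in> space (sample_space n P). \<forall>i<n. \<omega> i \<in> Zs} = 1"
proof -
  let ?S = "sample_space n P"
  interpret S: prob_space ?S by (rule prob_space_sample_space[OF P])
  have "{\<omega> \<in> space ?S. \<forall>i<n. \<omega> i \<in> Zs}
      = space ?S - (\<Union>i<n. space ?S - (\<lambda>\<omega>. \<omega> i) -` Zs \<inter> space ?S)"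
    by auto
  also have "\<dots> \<in> sets ?S"
    by (intro sets.Diff sets.top sets.finite_UN)
      (auto intro!: measurable_sets[OF measurable_sample_component Zs(1)])
  finally show A: "{\<omega> \<in> space ?S. \<forall>i<n. \<omega> i \<in> Zs} \<in> sets ?S" .
  have "AE \<omega> in ?S. \<forall>i\<in>{..<n}. \<omega> i \<in> Zs"
    using AE_sample_component[OF P _ AE_mem_of_emeasure_1[OF P Zs]]
    by (intro eventually_ball_finite) auto
  then have "AE \<omega> in ?S. \<omega> \<in> {\<omega> \<in> space ?S. \<forall>i<n. \<omega> i \<in> Zs}"
    using AE_space by eventually_elim auto
  then show "measure ?S {\<omega> \<in> space ?S. \<forall>i<n. \<omega> i \<in> Zs} = 1"
    using S.prob_eq_1[OF A] by blast
qed

lemma empirical_mean_deviation: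
  fixes g :: "'a \<Rightarrow> real"
  assumes P: "prob_space P" and g: "g \<in> borel_measurable P"
    and Zs: "Zs \<in> sets P" "emeasure P Zs = 1" and bound: "\<forall>z\<in>Zs. \<bar>g z\<bar> \<le> T"
    and "0 < n" and "0 < \<delta>" "\<delta> < 1"
  shows "\<exists>A \<in> sets (sample_space n P). measure (sample_space n P) A \<ge> 1 - \<delta> \<and>
           (\<forall>\<omega>\<in>A. (\<integral>z. g z \<partial>P) \<le> (1 / real n) * (\<Sum>i<n. g (\<omega> i))
                                    + sqrt 2 * T * sqrt (ln (1 / \<delta>) / real n))"
proof -
  let ?S = "sample_space n P"
  interpret P: prob_space P by fact
  interpret S: prob_space ?S by (rule prob_space_sample_space[OF P])
  have AE_Zs: "AE z in P. z \<in> Zs" by (rule AE_mem_of_emeasure_1[OF P Zs])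
  have "T \<ge> 0"
    using AE_Zs bound P.AE_False by (metis abs_ge_zero eventually_mono order_trans)
  then consider "T = 0" | "0 < T" by linarith
  then show ?thesis
  proof cases
    case 1
    \<comment> \<open>Hoeffding needs a nondegenerate range; here \<open>g = 0\<close> almost surely\<close>
    define A where "A = {\<omega> \<in> space ?S. \<forall>i<n. \<omega> i \<in> Zs}"
    note A = sample_in_full_set[OF P Zs, of n, folded A_def]
    have "(\<integral>z. g z \<partial>P) = 0"
      using AE_Zs bound 1 by (intro integral_eq_zero_AE) (auto elim!: eventually_mono)
    moreover have "(\<Sum>i<n. g (\<omega> i)) = 0" if "\<omega> \<in> A" for \<omega>
      using that bound 1 unfolding A_def by (intro sum.neutral) fastforce
    ultimately show ?thesis using A \<open>0 < \<delta>\<close> 1 by (intro bexI[of _ A]) auto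
  next
    case 2
    define t where "t = sqrt 2 * T * sqrt (ln (1 / \<delta>) / real n)"
    define B where "B = {\<omega> \<in> space ?S. (\<Sum>i<n. g (\<omega> i)) \<le> real n * (\<integral>z. g z \<partial>P) - real n * t}"
    have ln: "0 < ln (1 / \<delta>)" using \<open>0 < \<delta>\<close> \<open>\<delta> < 1\<close> by simp
    have t: "0 \<le> t" using 2 ln by (simp add: t_def)
    have "t\<^sup>2 = 2 * T\<^sup>2 * ln (1 / \<delta>) / real n"
      unfolding t_def using ln by (simp add: power_mult_distrib)
    then have "exp (- real n * t\<^sup>2 / (2 * T\<^sup>2)) = \<delta>"
      using 2 \<open>0 < n\<close> \<open>0 < \<delta>\<close> by (simp add: exp_minus)
    then have "measure ?S B \<le> \<delta>"
      using sample_sum_lower_tail[OF P g _ 2 \<open>0 < n\<close> t] AE_Zs bound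
      unfolding B_def by (force elim!: eventually_mono)
    moreover have B: "B \<in> sets ?S"
      unfolding B_def using measurable_compose[OF measurable_sample_component g] by measurable
    ultimately have "measure ?S (space ?S - B) \<ge> 1 - \<delta>" by (simp add: S.prob_compl)
    moreover have "(\<integral>z. g z \<partial>P) \<le> (1 / real n) * (\<Sum>i<n. g (\<omega> i)) + t" if "\<omega> \<in> space ?S - B" for \<omega>
      using that \<open>0 < n\<close> unfolding B_def by (auto simp: field_simps)
    ultimately show ?thesis using B unfolding t_def by blast
  qed
qed

section \<open>Nonnegativity of the Rademacher complexity\<close>

definition flip_signs :: "nat \<Rightarrow> (nat \<Rightarrow> 'a \<times> real) \<Rightarrow> nat \<Rightarrow> 'a \<times> real" where
  "flip_signs n = compose {..<n} (\<lambda>(x, \<sigma>). (x, - \<sigma>))"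

lemma prob_space_rademacher_dist: "prob_space rademacher_dist"
  unfolding rademacher_dist_def by (rule measure_pmf.prob_space_axioms)

lemma distr_rademacher_dist_uminus: "distr rademacher_dist rademacher_dist uminus = rademacher_dist"
proof -
  have "distr rademacher_dist rademacher_dist uminus
      = distr (measure_pmf (pmf_of_set {-1, 1::real})) (count_space UNIV) uminus"
    unfolding rademacher_dist_def by (intro distr_cong) auto
  also have "\<dots> = measure_pmf (map_pmf uminus (pmf_of_set {-1, 1::real}))"
    by (simp add: map_pmf_rep_eq)
  also have "map_pmf uminus (pmf_of_set {-1, 1::real}) = pmf_of_set {-1, 1}"
    by (subst map_pmf_of_set_inj) (auto simp: insert_commute)
  finally show ?thesis unfolding rademacher_dist_def .
qed

lemma distr_rad_space_flip_signs:
  assumes "prob_space P0"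
  shows "flip_signs n \<in> measurable (rad_space n P0) (rad_space n P0)"
    and "distr (rad_space n P0) (rad_space n P0) (flip_signs n) = rad_space n P0"
proof -
  let ?N = "P0 \<Otimes>\<^sub>M rademacher_dist"
  interpret pair_prob_space P0 rademacher_dist
    using assms prob_space_rademacher_dist by (simp add: pair_prob_space_def pair_sigma_finite_def
        prob_space_imp_sigma_finite)
  have uminus: "(uminus :: real \<Rightarrow> real) \<in> measurable rademacher_dist rademacher_dist"
    unfolding rademacher_dist_def by simp
  have flip: "(\<lambda>(x, \<sigma>). (x, - \<sigma>)) \<in> measurable ?N ?N"
    using measurable_Pair[OF measurable_fst measurable_compose[OF measurable_snd uminus]]
    by (simp add: split_beta')
  have "distr P0 P0 (\<lambda>x. x) \<Otimes>\<^sub>M distr rademacher_dist rademacher_dist uminus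
      = distr ?N ?N (\<lambda>(x, \<sigma>). (x, - \<sigma>))"
    by (rule pair_measure_distr[OF measurable_ident_sets[OF refl] uminus])
      (simp add: distr_rademacher_dist_uminus prob_space_imp_sigma_finite prob_space_rademacher_dist)
  then have flip_distr: "distr ?N ?N (\<lambda>(x, \<sigma>). (x, - \<sigma>)) = ?N"
    by (simp add: distr_rademacher_dist_uminus distr_id2)
  show "flip_signs n \<in> measurable (rad_space n P0) (rad_space n P0)"
    unfolding flip_signs_def compose_def rad_space_def
    by (intro measurable_restrict measurable_compose[OF _ flip] measurable_component_singleton) auto
  have "distr (rad_space n P0) (rad_space n P0) (flip_signs n)
      = PiM {..<n} (\<lambda>_. distr ?N ?N (\<lambda>(x, \<sigma>). (x, - \<sigma>)))"
    unfolding rad_space_def flip_signs_def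
    by (intro distr_PiM_finite_prob_space' flip P.prob_space_axioms) auto
  then show "distr (rad_space n P0) (rad_space n P0) (flip_signs n) = rad_space n P0"
    unfolding flip_distr rad_space_def .
qed

lemma rad_integrand_flip_signs_nonneg:
  assumes "G \<noteq> {}" and bound: "\<forall>g\<in>G. \<forall>z\<in>Zs. \<bar>g z - h z\<bar> \<le> T" and "\<forall>i<n. fst (\<omega> i) \<in> Zs"
  shows "0 \<le> rad_integrand n G \<omega> + rad_integrand n G (flip_signs n \<omega>)"
proof -
  define F where "F g = (1 / real n) * (\<Sum>i<n. snd (\<omega> i) * g (fst (\<omega> i)))" for g
  define B where "B = (1 / real n) * (\<Sum>i<n. \<bar>snd (\<omega> i)\<bar> * (T + \<bar>h (fst (\<omega> i))\<bar>))"
  have F_bound: "\<bar>F g\<bar> \<le> B" if "g \<in> G" for g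
  proof -
    have "\<bar>\<Sum>i<n. snd (\<omega> i) * g (fst (\<omega> i))\<bar> \<le> (\<Sum>i<n. \<bar>snd (\<omega> i) * g (fst (\<omega> i))\<bar>)"
      by (rule sum_abs)
    also have "\<dots> \<le> (\<Sum>i<n. \<bar>snd (\<omega> i)\<bar> * (T + \<bar>h (fst (\<omega> i))\<bar>))"
    proof (intro sum_mono)
      fix i assume "i \<in> {..<n}"
      then have "\<bar>g (fst (\<omega> i))\<bar> \<le> T + \<bar>h (fst (\<omega> i))\<bar>"
        using bound that assms(3) by fastforce
      then show "\<bar>snd (\<omega> i) * g (fst (\<omega> i))\<bar> \<le> \<bar>snd (\<omega> i)\<bar> * (T + \<bar>h (fst (\<omega> i))\<bar>)"
        by (simp add: abs_mult mult_left_mono)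
    qed
    finally show ?thesis unfolding F_def B_def by (simp add: abs_mult divide_right_mono)
  qed
  have flipped: "(1 / real n) * (\<Sum>i<n. snd (flip_signs n \<omega> i) * g (fst (flip_signs n \<omega> i))) = - F g"
    for g
    unfolding F_def flip_signs_def compose_def by (simp add: split_beta sum_negf)
  obtain g0 where g0: "g0 \<in> G" using assms(1) by auto
  have "F g0 \<le> rad_integrand n G \<omega>"
    unfolding rad_integrand_def F_def[symmetric]
    by (rule cSUP_upper[OF g0]) (use F_bound in \<open>force intro: bdd_aboveI2[of _ _ B]\<close>)
  moreover have "- F g0 \<le> rad_integrand n G (flip_signs n \<omega>)"
    unfolding rad_integrand_def flipped
    by (rule cSUP_upper[OF g0]) (use F_bound in \<open>force intro: bdd_aboveI2[of _ _ B]\<close>)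
  ultimately show ?thesis by simp
qed

lemma rademacher_complexity_nonneg:
  assumes P0: "prob_space P0" and Zs: "Zs \<in> sets P0" "emeasure P0 Zs = 1"
    and "G \<noteq> {}" and bound: "\<forall>g\<in>G. \<forall>z\<in>Zs. \<bar>g z - h z\<bar> \<le> T"
    and int: "integrable (rad_space n P0) (rad_integrand n G)"
  shows "0 \<le> rademacher_complexity n P0 G"
proof -
  let ?R = "rad_space n P0"
  let ?N = "P0 \<Otimes>\<^sub>M rademacher_dist"
  interpret pair_prob_space P0 rademacher_dist
    using P0 prob_space_rademacher_dist by (simp add: pair_prob_space_def pair_sigma_finite_def
        prob_space_imp_sigma_finite)
  note flip = distr_rad_space_flip_signs[OF P0]
  have meas: "rad_integrand n G \<in> borel_measurable ?R" using int by auto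
  have same_integral: "(\<integral>\<omega>. rad_integrand n G (flip_signs n \<omega>) \<partial>?R) = (\<integral>\<omega>. rad_integrand n G \<omega> \<partial>?R)"
    using integral_distr[OF flip(1) meas] flip(2) by simp
  have int_flip: "integrable ?R (\<lambda>\<omega>. rad_integrand n G (flip_signs n \<omega>))"
    using int flip(2) integrable_distr_eq[OF flip(1) meas] by simp
  have "emeasure ?N (Zs \<times> space rademacher_dist) = 1"
    using Zs by (simp add: M2.emeasure_pair_measure_Times M2.emeasure_space_1)
  then have "AE x in ?N. x \<in> Zs \<times> space rademacher_dist"
    using Zs(1) by (intro AE_mem_of_emeasure_1 P.prob_space_axioms) auto
  then have "AE x in ?N. fst x \<in> Zs" by (auto elim!: eventually_mono)
  then have "AE \<omega> in ?R. \<forall>i\<in>{..<n}. fst (\<omega> i) \<in> Zs"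
    unfolding rad_space_def
    by (intro eventually_ball_finite ballI AE_PiM_component P.prob_space_axioms) auto
  then have "0 \<le> (\<integral>\<omega>. rad_integrand n G \<omega> + rad_integrand n G (flip_signs n \<omega>) \<partial>?R)"
    by (intro integral_nonneg_AE)
      (auto elim!: eventually_mono intro: rad_integrand_flip_signs_nonneg[OF \<open>G \<noteq> {}\<close> bound])
  also have "\<dots> = 2 * (\<integral>\<omega>. rad_integrand n G \<omega> \<partial>?R)"
    using int int_flip same_integral by simp
  finally show ?thesis unfolding rademacher_complexity_def by simp
qed

lemma dro_risk_le_empirical_surrogate:
  assumes "0 < n" and Zs: "Zs \<in> sets (Zmeas m)"
    and P0: "prob_space P0" "sets P0 = sets (Zmeas m)" "emeasure P0 Zs = 1"
    and l: "l \<in> borel_measurable (Zmeas m)" "\<forall>z\<in>Zs. \<bar>l z\<bar> \<le> T"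
    and "0 \<le> \<rho>" "0 \<le> lam" "0 < \<delta>" "\<delta> < 1"
  shows "\<exists>A \<in> sets (sample_space n P0). measure (sample_space n P0) A \<ge> 1 - \<delta> \<and>
           (\<forall>\<omega>\<in>A. dro_risk (Zmeas m) Zs (cost_w m w) l P0 \<rho>
                    \<le> lam * \<rho> + (1 / real n) * (\<Sum>i<n. surrogate Zs (cost_w m w) l lam (\<omega> i))
                       + sqrt 2 * T * sqrt (ln (1 / \<delta>) / real n))"
proof -
  define s where "s = surrogate Zs (cost_w m w) l lam"
  have "Zs \<noteq> {}" using P0(3) by auto
  have l_le: "\<forall>z\<in>Zs. l z \<le> T" using l(2) by auto
  have s_bound: "\<forall>z\<in>Zs. \<bar>s z\<bar> \<le> T"
    unfolding s_def using abs_surrogate_le[where c="cost_w m w", OF l(2) cost_w_nonneg] \<open>0 \<le> lam\<close> by simp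
  have s_meas: "s \<in> borel_measurable (Zmeas m)"
    unfolding s_def using \<open>Zs \<noteq> {}\<close> l_le cost_w_nonneg \<open>0 \<le> lam\<close> continuous_on_cost_w
    by (intro borel_measurable_Zmeas borel_measurable_surrogate) auto
  have dom: "\<forall>\<xi>\<in>Zs. \<forall>z\<in>Zs. l \<xi> \<le> s z + lam * cost_w m w \<xi> z"
    unfolding s_def using surrogate_ge[where c="cost_w m w", OF l_le cost_w_nonneg \<open>0 \<le> lam\<close>]
    by (auto simp: diff_le_eq)
  have duality: "dro_risk (Zmeas m) Zs (cost_w m w) l P0 \<rho> \<le> lam * \<rho> + (\<integral>z. s z \<partial>P0)"
    by (rule dro_risk_le_surrogate_expectation[OF P0 Zs l s_meas s_bound cost_w_measurable
          cost_w_nonneg cost_w_self dom]) fact+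
  have "s \<in> borel_measurable P0" using s_meas P0(2) measurable_cong_sets by blast
  moreover have "Zs \<in> sets P0" using Zs P0(2) by simp
  ultimately obtain A where A: "A \<in> sets (sample_space n P0)" "measure (sample_space n P0) A \<ge> 1 - \<delta>"
    and deviation: "\<forall>\<omega>\<in>A. (\<integral>z. s z \<partial>P0) \<le> (1 / real n) * (\<Sum>i<n. s (\<omega> i))
                                      + sqrt 2 * T * sqrt (ln (1 / \<delta>) / real n)"
    using empirical_mean_deviation[OF P0(1) _ _ P0(3) s_bound \<open>0 < n\<close> \<open>0 < \<delta>\<close> \<open>\<delta> < 1\<close>]
    by blast
  show ?thesis
  proof (unfold s_def[symmetric], intro bexI[OF _ A(1)] conjI A(2) ballI)
    fix \<omega> assume "\<omega> \<in> A"
    then show "dro_risk (Zmeas m) Zs (cost_w m w) l P0 \<rho> \<le> lam * \<rho> + (1 / real n) * (\<Sum>i<n. s (\<omega> i))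
                 + sqrt 2 * T * sqrt (ln (1 / \<delta>) / real n)"
      using duality bspec[OF deviation \<open>\<omega> \<in> A\<close>] by linarith
  qed
qed

lemma dro_generalization_bound:
  fixes L :: "real \<Rightarrow> real \<Rightarrow> real" and f :: "(nat \<Rightarrow> real) \<Rightarrow> (nat \<Rightarrow> real) \<Rightarrow> real"
  assumes "0 < n" and "Xs \<times> Ys \<in> sets (Zmeas m)"
    and P0: "prob_space P0" "sets P0 = sets (Zmeas m)" "emeasure P0 (Xs \<times> Ys) = 1"
    and bound: "\<forall>t\<in>Theta m. \<forall>z\<in>Xs \<times> Ys. \<bar>L (f t (fst z)) (snd z)\<bar> \<le> T"
    and meas: "\<forall>t\<in>Theta m. (\<lambda>z. L (f t (fst z)) (snd z)) \<in> borel_measurable (Zmeas m)"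
    and int: "integrable (rad_space n P0)
                (rad_integrand n ((\<lambda>t z. L (f t (fst z)) (snd z) - L 0 (snd z)) ` Theta m))"
    and \<theta>: "\<theta> \<in> Theta m" and "\<rho> \<ge> 0" "lam \<ge> 0" "0 < \<delta>" "\<delta> < 1"
  shows "\<exists>A \<in> sets (sample_space n P0).
           measure (sample_space n P0) A \<ge> 1 - \<delta> \<and>
           (\<forall>\<omega>\<in>A.
              dro_risk (Zmeas m) (Xs \<times> Ys) (cost_w m w) (\<lambda>z. L (f \<theta> (fst z)) (snd z)) P0 \<rho>
              \<le> lam * \<rho>
                + (1 / real n) * (\<Sum>i<n. surrogate (Xs \<times> Ys) (cost_w m w)
                                        (\<lambda>z. L (f \<theta> (fst z)) (snd z)) lam (\<omega> i))
                + rademacher_complexity n P0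
                    ((\<lambda>t z. L (f t (fst z)) (snd z) - L 0 (snd z)) ` Theta m)
                + sqrt 2 * T * sqrt (ln (1 / \<delta>) / real n))"
proof -
  obtain A where A: "A \<in> sets (sample_space n P0)" "measure (sample_space n P0) A \<ge> 1 - \<delta>"
    and risk: "\<forall>\<omega>\<in>A. dro_risk (Zmeas m) (Xs \<times> Ys) (cost_w m w) (\<lambda>z. L (f \<theta> (fst z)) (snd z)) P0 \<rho>
       \<le> lam * \<rho> + (1 / real n) * (\<Sum>i<n. surrogate (Xs \<times> Ys) (cost_w m w)
                                         (\<lambda>z. L (f \<theta> (fst z)) (snd z)) lam (\<omega> i))
          + sqrt 2 * T * sqrt (ln (1 / \<delta>) / real n)"
    using dro_risk_le_empirical_surrogate[OF assms(1,2) P0 bspec[OF meas \<theta>] bspec[OF bound \<theta>]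
        assms(10-13)] by blast
  have "Theta m \<noteq> {}" unfolding Theta_def by auto
  \<comment> \<open>the centring \<open>L 0 y\<close> keeps the class within distance \<open>T\<close> of the function \<open>-L 0 y\<close>\<close>
  then have "0 \<le> rademacher_complexity n P0 ((\<lambda>t z. L (f t (fst z)) (snd z) - L 0 (snd z)) ` Theta m)"
    using bound assms(2) P0
    by (intro rademacher_complexity_nonneg[OF P0(1) _ P0(3) _ _ int, where h = "\<lambda>z. - L 0 (snd z)"])
      auto
  then show ?thesis
    by (intro bexI[OF _ A(1)] conjI A(2) ballI) (use risk in \<open>fastforce dest: bspec\<close>)
qed

theorem theorem1:
  shows "\<exists>k::real. k \<ge> 0 \<and>
    (\<forall>(m::nat) (n::nat) (P0 :: ((nat \<Rightarrow> real) \<times> real) measure) (Xs :: (nat \<Rightarrow> real) set)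
       (Ys :: real set) (f :: (nat \<Rightarrow> real) \<Rightarrow> (nat \<Rightarrow> real) \<Rightarrow> real) (L :: real \<Rightarrow> real \<Rightarrow> real)
       (T :: real) (w :: nat \<Rightarrow> real) (\<theta> :: nat \<Rightarrow> real) (\<rho> :: real) (lam :: real) (\<delta> :: real).
      n > 0 \<and>
      Xs \<times> Ys \<in> sets (Zmeas m) \<and>
      prob_space P0 \<and> sets P0 = sets (Zmeas m) \<and> emeasure P0 (Xs \<times> Ys) = 1 \<and>
      (\<forall>i\<le>m. w i \<ge> 1) \<and>
      (\<forall>t\<in>Theta m. \<forall>z\<in>Xs \<times> Ys. \<bar>L (f t (fst z)) (snd z)\<bar> \<le> T) \<and>
      (\<forall>z\<in>Xs \<times> Ys. continuous_on (Theta m) (\<lambda>t. L (f t (fst z)) (snd z))) \<and>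
      (\<forall>t\<in>Theta m. (\<lambda>z. L (f t (fst z)) (snd z)) \<in> borel_measurable (Zmeas m)) \<and>
      integrable (rad_space n P0)
        (rad_integrand n ((\<lambda>t z. L (f t (fst z)) (snd z) - L 0 (snd z)) ` Theta m)) \<and>
      \<theta> \<in> Theta m \<and> \<rho> \<ge> 0 \<and> lam \<ge> 0 \<and> 0 < \<delta> \<and> \<delta> < 1
      \<longrightarrow>
      (\<exists>A \<in> sets (sample_space n P0).
         measure (sample_space n P0) A \<ge> 1 - \<delta> \<and>
         (\<forall>\<omega>\<in>A.
            dro_risk (Zmeas m) (Xs \<times> Ys) (cost_w m w) (\<lambda>z. L (f \<theta> (fst z)) (snd z)) P0 \<rho>
            \<le> lam * \<rho>
              + (1 / real n) * (\<Sum>i<n. surrogate (Xs \<times> Ys) (cost_w m w)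
                                      (\<lambda>z. L (f \<theta> (fst z)) (snd z)) lam (\<omega> i))
              + rademacher_complexity n P0
                  ((\<lambda>t z. L (f t (fst z)) (snd z) - L 0 (snd z)) ` Theta m)
              + k * T * sqrt (ln (1 / \<delta>) / real n))))"
  apply (intro exI[of _ "sqrt 2"] conjI allI impI)
   apply simp
  subgoal for m n P0 Xs Ys f L
    by (elim conjE) (rule dro_generalization_bound[where L = L and f = f]; assumption)
  done

end
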